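(* Let $n\geq 1$ and let $C_n\subset \mathrm{SO}(3)$ be the cyclic group generated by an axial rotation of order $n$. Then $X(C_n,C_n)\cong \mathbb{R}P^3$ (homeomorphism).
   Context: For finite subgroups $G_1,G_2\subset \mathrm{SO}(3)$, the misorientation space is the topological orbit space $X(G_1,G_2)=\mathrm{SO}(3)/(G_1\times G_2)=G_1\backslash \mathrm{SO}(3)/G_2$, where $(g_1,g_2)\cdot A=g_1Ag_2^{-1}$. *)

theory Defs
  imports
    "HOL-Analysis.Analysis"
    "HOL-Algebra.Group_Action"
    "HOL-Algebra.Generated_Groups"
    "HOL-Algebra.Multiplicative_Group"
begin

section \<open>Quotient topologies\<close>

text \<open>The set \<open>f ` topspace X\<close> with the finest topology making \<open>f\<close> continuous. Taking
  \<open>f\<close> to be the map sending a point to its class yields the quotient space by an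
  equivalence relation.\<close>

definition quot_topology :: "'a topology \<Rightarrow> ('a \<Rightarrow> 'b) \<Rightarrow> 'b topology" where
  "quot_topology X f =
     topology (\<lambda>U. U \<subseteq> f ` topspace X \<and> openin X {x \<in> topspace X. f x \<in> U})"

lemma openin_quot_topology:
  "openin (quot_topology X f) U \<longleftrightarrow>
     U \<subseteq> f ` topspace X \<and> openin X {x \<in> topspace X. f x \<in> U}"
proof -
  have "istopology (\<lambda>U. U \<subseteq> f ` topspace X \<and> openin X {x \<in> topspace X. f x \<in> U})"
    unfolding istopology_def
  proof (intro conjI allI impI)
    fix S T
    assume S: "S \<subseteq> f ` topspace X \<and> openin X {x \<in> topspace X. f x \<in> S}"
      and T: "T \<subseteq> f ` topspace X \<and> openin X {x \<in> topspace X. f x \<in> T}"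
    then show "S \<inter> T \<subseteq> f ` topspace X" by blast
    have "{x \<in> topspace X. f x \<in> S \<inter> T} =
        {x \<in> topspace X. f x \<in> S} \<inter> {x \<in> topspace X. f x \<in> T}" by blast
    with S T show "openin X {x \<in> topspace X. f x \<in> S \<inter> T}" by auto
  next
    fix K
    assume K: "\<forall>S\<in>K. S \<subseteq> f ` topspace X \<and> openin X {x \<in> topspace X. f x \<in> S}"
    then show "\<Union>K \<subseteq> f ` topspace X" by blast
    have "{x \<in> topspace X. f x \<in> \<Union>K} = (\<Union>S\<in>K. {x \<in> topspace X. f x \<in> S})" by blast
    with K show "openin X {x \<in> topspace X. f x \<in> \<Union>K}" by auto
  qed
  then show ?thesis
    by (simp add: quot_topology_def)
qed

lemma topspace_quot_topology: "topspace (quot_topology X f) = f ` topspace X"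
proof
  show "topspace (quot_topology X f) \<subseteq> f ` topspace X"
    using openin_quot_topology [of X f "topspace (quot_topology X f)"] by simp
  have "{x \<in> topspace X. f x \<in> f ` topspace X} = topspace X" by blast
  then have "openin (quot_topology X f) (f ` topspace X)"
    by (simp add: openin_quot_topology)
  then show "f ` topspace X \<subseteq> topspace (quot_topology X f)"
    by (rule openin_subset)
qed

lemma quotient_map_quot_topology: "quotient_map X (quot_topology X f) f"
  by (auto simp: quotient_map_def topspace_quot_topology openin_quot_topology)


section \<open>Real projective space\<close>

text \<open>A nonzero vector is sent to the line through the origin that it spans, so
  \<open>real ^ 'n\<close> gives the projective space of dimension \<open>CARD('n) - 1\<close>.\<close>

definition real_projective_space :: "(real ^ 'n::finite) set topology" where
  "real_projective_space = quot_topology (top_of_set (- {0})) (\<lambda>x. span {x})"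

abbreviation RP3 :: "(real ^ 4) set topology" where
  "RP3 \<equiv> real_projective_space"


section \<open>The rotation group\<close>

definition SO3 :: "(real ^ 3 ^ 3) monoid" where
  "SO3 = \<lparr>carrier = {A. orthogonal_matrix A \<and> det A = 1}, mult = (**), one = mat 1\<rparr>"

lemma group_SO3: "Group.group SO3"
proof (rule groupI)
  fix A assume A: "A \<in> carrier SO3"
  then have "transpose A \<in> carrier SO3"
    by (simp add: SO3_def)
  moreover have "transpose A \<otimes>\<^bsub>SO3\<^esub> A = \<one>\<^bsub>SO3\<^esub>"
    using A by (simp add: SO3_def orthogonal_matrix)
  ultimately show "\<exists>B\<in>carrier SO3. B \<otimes>\<^bsub>SO3\<^esub> A = \<one>\<^bsub>SO3\<^esub>"
    by blast
qed (auto simp: SO3_def orthogonal_matrix_mul orthogonal_matrix_id det_mul matrix_mul_assoc)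

lemma inv_SO3: "A \<in> carrier SO3 \<Longrightarrow> inv\<^bsub>SO3\<^esub> A = transpose A"
  by (rule group.inv_equality [OF group_SO3]) (simp_all add: SO3_def orthogonal_matrix_def)

lemma finite_subgroup_generate_SO3:
  assumes "R \<in> carrier SO3" "group.ord SO3 R \<ge> 1"
  shows "subgroup (generate SO3 {R}) SO3" "finite (generate SO3 {R})"
proof -
  interpret S: Group.group SO3 by (rule group_SO3)
  show "subgroup (generate SO3 {R}) SO3"
    using assms by (intro S.generate_is_subgroup) simp
  show "finite (generate SO3 {R})"
    using assms S.generate_pow_card [of R] by (intro card_ge_0_finite) simp
qed

text \<open>The line spanned by \<open>u\<close> is the axis; the identity counts as the rotation by angle zero.\<close>

definition axial_rotation :: "real ^ 3 ^ 3 \<Rightarrow> bool" where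
  "axial_rotation R \<longleftrightarrow> R \<in> carrier SO3 \<and> (\<exists>u. u \<noteq> 0 \<and> R *v u = u)"


section \<open>Misorientation spaces\<close>

definition orbit_space :: "('g, 'm) monoid_scheme \<Rightarrow> ('g \<Rightarrow> 'a \<Rightarrow> 'a) \<Rightarrow> 'a topology \<Rightarrow> 'a set topology"
  where "orbit_space G \<phi> X = quot_topology X (orbit G \<phi>)"

lemma topspace_orbit_space: "topspace (orbit_space G \<phi> X) = orbits G (topspace X) \<phi>"
  by (auto simp: orbit_space_def topspace_quot_topology orbits_def)

text \<open>The restriction to the carrier is needed because \<^const>\<open>BijGroup\<close> consists of
  extensional functions.\<close>

definition misorientation_action ::
  "(real ^ 3 ^ 3) \<times> (real ^ 3 ^ 3) \<Rightarrow> real ^ 3 ^ 3 \<Rightarrow> real ^ 3 ^ 3" where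
  "misorientation_action =
     (\<lambda>(g1, g2). \<lambda>A\<in>carrier SO3. g1 \<otimes>\<^bsub>SO3\<^esub> A \<otimes>\<^bsub>SO3\<^esub> inv\<^bsub>SO3\<^esub> g2)"

definition misorientation_space ::
  "(real ^ 3 ^ 3) set \<Rightarrow> (real ^ 3 ^ 3) set \<Rightarrow> (real ^ 3 ^ 3) set topology" where
  "misorientation_space G1 G2 =
     orbit_space (SO3\<lparr>carrier := G1\<rparr> \<times>\<times> SO3\<lparr>carrier := G2\<rparr>) misorientation_action
       (top_of_set (carrier SO3))"

lemma group_action_misorientation:
  assumes "subgroup G1 SO3" "subgroup G2 SO3"
  shows "group_action (SO3\<lparr>carrier := G1\<rparr> \<times>\<times> SO3\<lparr>carrier := G2\<rparr>) (carrier SO3)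
           misorientation_action"
proof -
  interpret S: Group.group SO3 by (rule group_SO3)
  interpret G1: subgroup G1 SO3 by fact
  interpret G2: subgroup G2 SO3 by fact
  let ?G = "SO3\<lparr>carrier := G1\<rparr> \<times>\<times> SO3\<lparr>carrier := G2\<rparr>"
  have bij: "misorientation_action (g, h) \<in> Bij (carrier SO3)"
    if "g \<in> carrier SO3" "h \<in> carrier SO3" for g h
  proof -
    have cancel: "A \<otimes>\<^bsub>SO3\<^esub> inv\<^bsub>SO3\<^esub> h \<otimes>\<^bsub>SO3\<^esub> h = A" "A \<otimes>\<^bsub>SO3\<^esub> h \<otimes>\<^bsub>SO3\<^esub> inv\<^bsub>SO3\<^esub> h = A"
      if "A \<in> carrier SO3" for A
      using that \<open>h \<in> carrier SO3\<close> by (simp_all add: S.m_assoc)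
    have "bij_betw (misorientation_action (g, h)) (carrier SO3) (carrier SO3)"
      using that
      by (intro bij_betw_byWitness [where f' = "\<lambda>A. inv\<^bsub>SO3\<^esub> g \<otimes>\<^bsub>SO3\<^esub> A \<otimes>\<^bsub>SO3\<^esub> h"])
        (auto simp: misorientation_action_def cancel simp flip: S.m_assoc)
    then show ?thesis
      by (simp add: Bij_def misorientation_action_def)
  qed
  have "group_hom ?G (BijGroup (carrier SO3)) misorientation_action"
  proof (intro group_hom.intro group_hom_axioms.intro homI)
    show "Group.group ?G"
      using assms by (intro DirProd_group S.subgroup_imp_group)
    show "Group.group (BijGroup (carrier SO3))"
      by (rule group_BijGroup)
  next
    fix x assume "x \<in> carrier ?G"
    then show "misorientation_action x \<in> carrier (BijGroup (carrier SO3))"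
      using bij by (auto simp: BijGroup_def)
  next
    fix x y assume "x \<in> carrier ?G" "y \<in> carrier ?G"
    then obtain g h g' h' where xy: "x = (g, h)" "y = (g', h')"
      and mem: "g \<in> carrier SO3" "h \<in> carrier SO3" "g' \<in> carrier SO3" "h' \<in> carrier SO3"
      by auto
    have "misorientation_action (g \<otimes>\<^bsub>SO3\<^esub> g', h \<otimes>\<^bsub>SO3\<^esub> h') =
        compose (carrier SO3) (misorientation_action (g, h)) (misorientation_action (g', h'))"
      using mem
      by (auto simp: fun_eq_iff compose_def misorientation_action_def restrict_def
          S.inv_mult_group S.m_assoc)
    then show "misorientation_action (x \<otimes>\<^bsub>?G\<^esub> y) =
        misorientation_action x \<otimes>\<^bsub>BijGroup (carrier SO3)\<^esub> misorientation_action y"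
      using bij mem by (simp add: xy BijGroup_def)
  qed
  then show ?thesis
    by (rule group_action.intro)
qed

end

theory Submission
  imports Defs
begin

text \<open>Write unit quaternions as pairs \<open>(z, w)\<close> of complex numbers with
  \<open>\<bar>z\<bar>\<^sup>2 + \<bar>w\<bar>\<^sup>2 = 1\<close>. They double cover \<open>SO(3)\<close>, and in suitable coordinates the
  rotations about the axis of \<open>R\<close> are the images of the pairs \<open>(e, 0)\<close>. Multiplying
  \<open>(z, w)\<close> by \<open>(e, 0)\<close> on the left and by \<open>(f, 0)\<close> on the right gives
  \<open>(e f z, e f\<^sup>* w)\<close>, where \<open>f\<^sup>*\<close> is the conjugate; so the double coset space is the quotient
  of the three-sphere by a group of diagonal matrices. For the cyclic group of order \<open>n\<close> the
  numbers \<open>e\<close> and \<open>f\<close> run through the roots of unity of order \<open>2 n\<close>, and the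
  diagonal matrices that occur are exactly those with entries \<open>\<alpha>, \<beta>\<close> such that
  \<open>\<alpha> ^ n = \<beta> ^ n = s\<close> with \<open>s = 1\<close> or \<open>s = - 1\<close>
  (lemma \<open>double_coset_iff_powers\<close>).

  Two points of the sphere are therefore in the same orbit iff their images under
  \<open>(z, w) \<mapsto> (z ^ n, w ^ n)\<close> agree up to sign. Since the points have norm one, this is the same
  as asking that the two images span the same real line in \<open>\<complex>\<^sup>2 = \<real>\<^sup>4\<close>
  (lemma \<open>unit_powers_span_eq_iff\<close>), so the sphere maps onto both the double coset space and
  \<open>RP3\<close>, with the same fibres. The sphere is compact and \<open>SO(3)\<close> and \<open>RP3\<close> are
  Hausdorff, which makes both maps quotient maps, and two quotients with the same fibres are
  homeomorphic.\<close>

section \<open>Topological preliminaries\<close>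

lemma homeomorphic_space_quotient_maps:
  assumes f: "quotient_map X Y f" and g: "quotient_map X Z g"
    and fibres: "\<And>x y. x \<in> topspace X \<Longrightarrow> y \<in> topspace X \<Longrightarrow> f x = f y \<longleftrightarrow> g x = g y"
  shows "Y homeomorphic_space Z"
proof -
  obtain h where h: "continuous_map Y Z h" "\<And>x. x \<in> topspace X \<Longrightarrow> h (f x) = g x"
    using quotient_map_lift_exists [OF f quotient_imp_continuous_map [OF g]] fibres by metis
  obtain k where k: "continuous_map Z Y k" "\<And>x. x \<in> topspace X \<Longrightarrow> k (g x) = f x"
    using quotient_map_lift_exists [OF g quotient_imp_continuous_map [OF f]] fibres by metis
  have "topspace Y = f ` topspace X" "topspace Z = g ` topspace X"
    using f g by (simp_all add: quotient_map_def)
  then have "homeomorphic_maps Y Z h k"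
    using h k unfolding homeomorphic_maps_def by auto
  then show ?thesis
    unfolding homeomorphic_space_def by blast
qed

lemma span_singleton_eq_iff:
  fixes x y :: "'a::real_vector"
  assumes "x \<noteq> 0" "y \<noteq> 0"
  shows "span {x} = span {y} \<longleftrightarrow> (\<exists>t. x = t *\<^sub>R y)"
proof
  assume "span {x} = span {y}"
  then have "x \<in> span {y}"
    by (metis insertI1 span_base)
  then show "\<exists>t. x = t *\<^sub>R y"
    by (auto simp: span_singleton)
next
  assume "\<exists>t. x = t *\<^sub>R y"
  then obtain t where t: "x = t *\<^sub>R y" by blast
  with assms have t0: "t \<noteq> 0" by auto
  show "span {x} = span {y}"
  proof
    show "span {x} \<subseteq> span {y}"
      unfolding t by (intro span_minimal) (auto intro: span_base span_scale)
    have "y = inverse t *\<^sub>R x"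
      using t t0 by simp
    then have "y \<in> span {x}"
      by (metis insertI1 span_base span_scale)
    then show "span {y} \<subseteq> span {x}"
      by (intro span_minimal) auto
  qed
qed

text \<open>The matrix of the orthogonal projection onto the line spanned by \<open>x\<close>. Unlike \<open>x\<close> it
  depends only on the line, so it maps projective space injectively and continuously into a Euclidean
  space; this is how the Hausdorff property is obtained.\<close>

definition line_projection :: "real ^ 'n::finite \<Rightarrow> real ^ 'n ^ 'n" where
  "line_projection x = (\<chi> i j. x $ i * x $ j / (x \<bullet> x))"

lemma line_projection_eq_iff:
  assumes "x \<noteq> 0" "y \<noteq> 0"
  shows "line_projection x = line_projection y \<longleftrightarrow> span {x} = span {y}"
proof
  assume eq: "line_projection x = line_projection y"
  have "x = ((y \<bullet> x) / (y \<bullet> y)) *\<^sub>R y"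
  proof (subst vec_eq_iff, rule allI)
    \<comment> \<open>Apply both projections, which agree, to the vector \<open>x\<close>, which the first one fixes.\<close>
    fix i
    have "x $ i * x $ j / (x \<bullet> x) = y $ i * y $ j / (y \<bullet> y)" for j
      using eq by (simp add: line_projection_def vec_eq_iff)
    then have "(\<Sum>j\<in>UNIV. x $ i * x $ j / (x \<bullet> x) * x $ j) =
        (\<Sum>j\<in>UNIV. y $ i * y $ j / (y \<bullet> y) * x $ j)"
      by simp
    moreover have "(\<Sum>j\<in>UNIV. u $ i * u $ j / (u \<bullet> u) * x $ j) = u $ i / (u \<bullet> u) * (u \<bullet> x)" for u
      by (simp add: inner_vec_def [of u x] sum_distrib_left sum_divide_distrib mult_ac)
    ultimately have "x $ i / (x \<bullet> x) * (x \<bullet> x) = y $ i / (y \<bullet> y) * (y \<bullet> x)"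
      by simp
    then show "x $ i = (((y \<bullet> x) / (y \<bullet> y)) *\<^sub>R y) $ i"
      using assms by simp
  qed
  then show "span {x} = span {y}"
    using assms span_singleton_eq_iff by blast
next
  assume "span {x} = span {y}"
  then obtain t where t: "x = t *\<^sub>R y"
    using assms span_singleton_eq_iff by blast
  with assms have "t \<noteq> 0" by auto
  then show "line_projection x = line_projection y"
    by (simp add: t line_projection_def vec_eq_iff)
qed

lemma Hausdorff_real_projective_space:
  "Hausdorff_space (real_projective_space :: (real ^ 'n::finite) set topology)"
proof -
  let ?q = "\<lambda>x :: real ^ 'n. span {x}"
  have q: "quotient_map (top_of_set (- {0})) real_projective_space ?q"
    unfolding real_projective_space_def by (rule quotient_map_quot_topology)
  have "continuous_map (top_of_set (- {0 :: real ^ 'n})) euclidean line_projection"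
    unfolding line_projection_def by (auto intro!: continuous_intros)
  then obtain g :: "(real ^ 'n) set \<Rightarrow> real ^ 'n ^ 'n" where
    g: "continuous_map real_projective_space euclidean g"
      "\<And>x. x \<in> - {0} \<Longrightarrow> g (span {x}) = line_projection x"
    by (rule quotient_map_lift_exists [OF q]) (auto simp: line_projection_eq_iff)
  moreover have "topspace real_projective_space = ?q ` (- {0})"
    by (simp add: real_projective_space_def topspace_quot_topology)
  then have "inj_on g (topspace real_projective_space)"
    by (auto simp: inj_on_def g(2) line_projection_eq_iff)
  ultimately show ?thesis
    using Hausdorff_space_euclidean Hausdorff_space_injective_preimage by blast
qed


section \<open>Rotations from unit quaternions\<close>

text \<open>Conjugation by the quaternion \<open>z + w k\<close> on the imaginary quaternions, where
  the vector with entries \<open>Re c, Im c, t\<close> stands for \<open>c j + t i\<close>. It maps \<open>(c, t)\<close> to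
  \<open>(z\<^sup>2 c - w\<^sup>2 c\<^sup>* + 2 t z w, t (\<bar>z\<bar>\<^sup>2 - \<bar>w\<bar>\<^sup>2) - 2 Re (z w\<^sup>* c))\<close>, with \<open>c\<^sup>*\<close> and
  \<open>w\<^sup>*\<close> the conjugates. With this choice of axes the rotations about the third axis
  come from the quaternions with \<open>w = 0\<close>.\<close>

definition quaternion_rotation :: "complex \<Rightarrow> complex \<Rightarrow> real ^ 3 ^ 3" where
  "quaternion_rotation z w = vector
     [vector [Re (z\<^sup>2 - w\<^sup>2), - Im (z\<^sup>2 + w\<^sup>2), 2 * Re (z * w)],
      vector [Im (z\<^sup>2 - w\<^sup>2), Re (z\<^sup>2 + w\<^sup>2), 2 * Im (z * w)],
      vector [- 2 * Re (z * cnj w), 2 * Im (z * cnj w), (cmod z)\<^sup>2 - (cmod w)\<^sup>2]]"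

definition plane_rotation :: "complex \<Rightarrow> real ^ 3 ^ 3" where
  "plane_rotation c = vector
     [vector [Re c, - Im c, 0], vector [Im c, Re c, 0], vector [0, 0, 1]]"

lemmas matrix3_simps = vec_eq_iff forall_3 matrix_matrix_mult_def matrix_vector_mult_def
  sum_3 transpose_def mat_def axis_def

lemma quaternion_rotation_Complex:
  "quaternion_rotation (Complex a b) (Complex p q) = vector
     [vector [a * a - b * b - p * p + q * q, - 2 * a * b - 2 * p * q, 2 * a * p - 2 * b * q],
      vector [2 * a * b - 2 * p * q, a * a - b * b + p * p - q * q, 2 * a * q + 2 * b * p],
      vector [- 2 * a * p - 2 * b * q, 2 * b * p - 2 * a * q, a * a + b * b - p * p - q * q]]"
  unfolding quaternion_rotation_def cmod_power2
  by (simp add: vec_eq_iff forall_3 power2_eq_square algebra_simps)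

lemma transpose_quaternion_rotation_mult:
  "transpose (quaternion_rotation z w) ** quaternion_rotation z w =
     mat (((cmod z)\<^sup>2 + (cmod w)\<^sup>2)\<^sup>2)"
  by (cases z; cases w; simp only: cmod_power2 quaternion_rotation_Complex complex.sel)
    (simp add: matrix3_simps algebra_simps power2_eq_square)

lemma det_quaternion_rotation:
  "det (quaternion_rotation z w) = ((cmod z)\<^sup>2 + (cmod w)\<^sup>2) ^ 3"
  by (cases z; cases w; simp only: cmod_power2 quaternion_rotation_Complex complex.sel)
    (simp add: det_3 algebra_simps power2_eq_square power3_eq_cube)

lemma quaternion_rotation_plane:
  "cmod e = 1 \<Longrightarrow> quaternion_rotation e 0 = plane_rotation (e\<^sup>2)"
  by (simp add: quaternion_rotation_def plane_rotation_def)

lemma plane_rotation_mult: "plane_rotation c ** plane_rotation d = plane_rotation (c * d)"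
  by (simp add: plane_rotation_def matrix3_simps algebra_simps)

lemma plane_rotation_1: "plane_rotation 1 = mat 1"
  by (simp add: plane_rotation_def matrix3_simps)

lemma transpose_plane_rotation: "transpose (plane_rotation c) = plane_rotation (cnj c)"
  by (simp add: plane_rotation_def matrix3_simps)

lemma plane_rotation_eq_iff: "plane_rotation c = plane_rotation d \<longleftrightarrow> c = d"
  by (auto simp: plane_rotation_def matrix3_simps complex_eq_iff)

lemma quaternion_rotation_in_SO3:
  assumes "(cmod z)\<^sup>2 + (cmod w)\<^sup>2 = 1"
  shows "quaternion_rotation z w \<in> carrier SO3"
  using assms
  by (simp add: SO3_def orthogonal_matrix transpose_quaternion_rotation_mult det_quaternion_rotation)

lemma plane_rotation_in_SO3:
  assumes "cmod c = 1"
  shows "plane_rotation c \<in> carrier SO3"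
proof -
  have "cmod (csqrt c) = 1"
    using assms by simp
  then show ?thesis
    using quaternion_rotation_in_SO3 [of "csqrt c" 0] quaternion_rotation_plane [of "csqrt c"] by simp
qed

text \<open>Of the multiplicativity of \<open>quaternion_rotation\<close>, only products with quaternions
  \<open>(e, 0)\<close> are needed. Then all entries of the matrix change in a simple way: on the left,
  \<open>z\<^sup>2\<close>, \<open>w\<^sup>2\<close> and \<open>z w\<close> are multiplied by \<open>e\<^sup>2\<close>, and \<open>z w\<^sup>*\<close> and the norms stay the same. On
  the right, \<open>z w\<close> and \<open>z w\<^sup>*\<close> change places, and \<open>w\<^sup>2\<close> is multiplied by the conjugate of
  \<open>e\<^sup>2\<close> instead.\<close>

lemma quaternion_rotation_plane_mult:
  assumes "cmod e = 1"
  shows "plane_rotation (e\<^sup>2) ** quaternion_rotation z w = quaternion_rotation (e * z) (e * w)"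
proof -
  have "e * cnj e = 1"
    using complex_norm_square [of e] assms by simp
  then have "e * z * cnj (e * w) = z * cnj w"
    by (metis (no_types, opaque_lifting) complex_cnj_mult mult.assoc mult.commute mult_1)
  moreover have "(e * z)\<^sup>2 = e\<^sup>2 * z\<^sup>2" "(e * w)\<^sup>2 = e\<^sup>2 * w\<^sup>2" "e * z * (e * w) = e\<^sup>2 * (z * w)"
    by (simp_all add: power2_eq_square mult_ac)
  moreover have "cmod (e * z) = cmod z" "cmod (e * w) = cmod w"
    by (simp_all add: norm_mult assms)
  ultimately show ?thesis
    unfolding quaternion_rotation_def plane_rotation_def
    by (simp only:) (simp add: matrix3_simps algebra_simps del: Re_power2 Im_power2)
qed

lemma quaternion_rotation_mult_plane:
  assumes "cmod e = 1"
  shows "quaternion_rotation z w ** plane_rotation (e\<^sup>2) = quaternion_rotation (z * e) (w * cnj e)"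
proof -
  define c where "c = e\<^sup>2"
  have "e * cnj e = 1"
    using complex_norm_square [of e] assms by simp
  then have "z * e * (w * cnj e) = z * w"
    by (metis (no_types, opaque_lifting) mult.assoc mult.commute mult_1)
  moreover have "(z * e)\<^sup>2 = c * z\<^sup>2" "(w * cnj e)\<^sup>2 = cnj c * w\<^sup>2"
    "z * e * cnj (w * cnj e) = c * (z * cnj w)"
    by (simp_all add: c_def power2_eq_square mult_ac)
  moreover have "cmod (z * e) = cmod z" "cmod (w * cnj e) = cmod w"
    by (simp_all add: norm_mult assms)
  ultimately show ?thesis
    unfolding quaternion_rotation_def plane_rotation_def c_def [symmetric]
    by (simp only:) (simp add: matrix3_simps algebra_simps)
qed
text \<open>The double cover has kernel \<open>{1, - 1}\<close>: the first two rows of the matrix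
  determine \<open>z\<^sup>2\<close>, \<open>w\<^sup>2\<close> and \<open>z w\<close>, hence \<open>(z, w)\<close> up to a common sign.\<close>

lemma quaternion_rotation_eq_iff:
  "quaternion_rotation z w = quaternion_rotation z' w' \<longleftrightarrow>
     z = z' \<and> w = w' \<or> z = - z' \<and> w = - w'"
proof
  assume "quaternion_rotation z w = quaternion_rotation z' w'"
  then have "Re (z\<^sup>2) = Re (z'\<^sup>2)" "Im (z\<^sup>2) = Im (z'\<^sup>2)" "Re (w\<^sup>2) = Re (w'\<^sup>2)" "Im (w\<^sup>2) = Im (w'\<^sup>2)"
    and "Re (z * w) = Re (z' * w')" "Im (z * w) = Im (z' * w')"
    by (simp_all add: quaternion_rotation_def vec_eq_iff forall_3)
  then have "z\<^sup>2 = z'\<^sup>2" "w\<^sup>2 = w'\<^sup>2" "z * w = z' * w'"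
    by (simp_all only: complex_eq_iff)
  then show "z = z' \<and> w = w' \<or> z = - z' \<and> w = - w'"
    by (auto simp: power2_eq_iff)
next
  assume "z = z' \<and> w = w' \<or> z = - z' \<and> w = - w'"
  then show "quaternion_rotation z w = quaternion_rotation z' w'"
    by (auto simp: quaternion_rotation_def)
qed

lemma SO3_fixing_axis:
  assumes A: "A \<in> carrier SO3" and axis: "A *v axis 3 1 = axis 3 1"
  obtains c where "cmod c = 1" "A = plane_rotation c"
proof -
  have orth: "transpose A ** A = mat 1" and det: "det A = 1"
    using A by (auto simp: SO3_def orthogonal_matrix)
  have "transpose A *v axis 3 1 = transpose A *v (A *v axis 3 1)"
    by (simp add: axis)
  also have "\<dots> = axis 3 1"
    by (simp add: matrix_vector_mul_assoc orth)
  finally have row: "A$3$1 = 0" "A$3$2 = 0" "A$3$3 = 1"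
    by (simp_all add: matrix3_simps)
  have col: "A$1$3 = 0" "A$2$3 = 0"
    using axis by (simp_all add: matrix3_simps)
  have 1: "A$1$1 * A$1$1 + A$2$1 * A$2$1 = 1" and 2: "A$1$1 * A$1$2 + A$2$1 * A$2$2 = 0"
    using orth by (simp_all add: matrix3_simps row col)
  have 3: "A$1$1 * A$2$2 - A$1$2 * A$2$1 = 1"
    using det by (simp add: det_3 row col)
  \<comment> \<open>Combinations of the three relations between the entries of the upper left block that
    isolate the two entries of its second column.\<close>
  have "A$2$2 * (A$1$1 * A$1$1 + A$2$1 * A$2$1) =
      A$1$1 * (A$1$1 * A$2$2 - A$1$2 * A$2$1) + A$2$1 * (A$1$1 * A$1$2 + A$2$1 * A$2$2)"
    by (simp add: algebra_simps)
  then have "A$2$2 = A$1$1"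
    by (simp add: 1 2 3)
  moreover have "A$1$2 * (A$1$1 * A$1$1 + A$2$1 * A$2$1) =
      A$1$1 * (A$1$1 * A$1$2 + A$2$1 * A$2$2) - A$2$1 * (A$1$1 * A$2$2 - A$1$2 * A$2$1)"
    by (simp add: algebra_simps)
  then have "A$1$2 = - A$2$1"
    by (simp add: 1 2 3)
  ultimately have "A = plane_rotation (Complex (A$1$1) (A$2$1))"
    by (simp add: plane_rotation_def matrix3_simps row col)
  moreover have "cmod (Complex (A$1$1) (A$2$1)) = 1"
    using 1 by (simp add: cmod_def power2_eq_square)
  ultimately show thesis
    using that by blast
qed

text \<open>The image of the third axis is \<open>(2 z w, \<bar>z\<bar>\<^sup>2 - \<bar>w\<bar>\<^sup>2)\<close>, a form of the Hopf map. To hit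
  a given \<open>v\<close> one may take \<open>z\<close> real, and then \<open>w\<close> is found by division unless \<open>v\<close> is the
  south pole.\<close>

lemma quaternion_rotation_transitive:
  fixes v :: "real ^ 3"
  assumes "norm v = 1"
  obtains z w where "(cmod z)\<^sup>2 + (cmod w)\<^sup>2 = 1" "quaternion_rotation z w *v axis 3 1 = v"
proof -
  have v: "(v$1)\<^sup>2 + (v$2)\<^sup>2 + (v$3)\<^sup>2 = 1"
    using assms by (simp add: norm_eq_1 inner_vec_def sum_3 power2_eq_square)
  show thesis
  proof (cases "v$3 = -1")
    case True
    with v have "v$1 = 0" "v$2 = 0"
      by (auto simp: sum_power2_eq_zero_iff)
    with True show thesis
      by (intro that [of 0 1]) (auto simp: quaternion_rotation_def matrix3_simps)
  next
    case False
    define r where "r = sqrt ((1 + v$3) / 2)"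
    define w where "w = Complex (v$1 / (2 * r)) (v$2 / (2 * r))"
    have "(v$3)\<^sup>2 \<le> 1\<^sup>2"
      using v by (smt (verit) one_power2 zero_le_power2)
    then have "\<bar>v$3\<bar> \<le> 1"
      by (simp add: abs_le_square_iff [of _ 1, simplified])
    with False have "1 + v$3 > 0" by linarith
    then have r: "r > 0" "r\<^sup>2 = (1 + v$3) / 2"
      by (simp_all add: r_def)
    have "(cmod w)\<^sup>2 = ((v$1)\<^sup>2 + (v$2)\<^sup>2) / (4 * r\<^sup>2)"
      by (simp add: w_def cmod_power2 power_divide power_mult_distrib add_divide_distrib)
    also have "\<dots> = (1 - v$3) / 2"
    proof -
      have "(v$1)\<^sup>2 + (v$2)\<^sup>2 = (1 - v$3) * (1 + v$3)"
        using v by (simp add: algebra_simps power2_eq_square)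
      then show ?thesis
        using \<open>1 + v$3 > 0\<close> by (simp add: r(2) divide_simps)
    qed
    finally have w: "(cmod w)\<^sup>2 = (1 - v$3) / 2" .
    show thesis
    proof (rule that [of "of_real r" w])
      show "(cmod (of_real r))\<^sup>2 + (cmod w)\<^sup>2 = 1"
        using r by (simp add: w field_simps)
      show "quaternion_rotation (of_real r) w *v axis 3 1 = v"
        using r by (simp add: quaternion_rotation_def matrix3_simps w) (simp add: w_def field_simps)
    qed
  qed
qed

text \<open>Surjectivity of the double cover: correct \<open>A\<close> by a quaternion rotation that moves the
  third axis to the same place, and what is left is a rotation about that axis.\<close>

lemma SO3_quaternion_rotation:
  assumes A: "A \<in> carrier SO3"
  obtains z w where "(cmod z)\<^sup>2 + (cmod w)\<^sup>2 = 1" "A = quaternion_rotation z w"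
proof -
  interpret S: Group.group SO3 by (rule group_SO3)
  have "orthogonal_transformation ((*v) A)"
    using A by (simp add: SO3_def orthogonal_transformation_matrix)
  from orthogonal_transformation_norm [OF this, of "axis 3 1"] have "norm (A *v axis 3 1) = 1"
    by simp
  then obtain z w where zw: "(cmod z)\<^sup>2 + (cmod w)\<^sup>2 = 1"
    and eq: "quaternion_rotation z w *v axis 3 1 = A *v axis 3 1"
    by (rule quaternion_rotation_transitive)
  let ?T = "quaternion_rotation z w"
  have T: "?T \<in> carrier SO3"
    using zw by (rule quaternion_rotation_in_SO3)
  then have orth: "transpose ?T ** ?T = mat 1" "?T ** transpose ?T = mat 1"
    by (simp_all add: SO3_def orthogonal_matrix_def)
  have "transpose ?T ** A \<in> carrier SO3"
    using S.m_closed [OF S.inv_closed [OF T] A] by (simp add: inv_SO3 T) (simp add: SO3_def)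
  moreover have "(transpose ?T ** A) *v axis 3 1 = axis 3 1"
    by (simp only: matrix_vector_mul_assoc [symmetric] eq [symmetric])
      (simp only: matrix_vector_mul_assoc orth matrix_vector_mul_lid)
  ultimately obtain c where c: "cmod c = 1" "transpose ?T ** A = plane_rotation c"
    by (rule SO3_fixing_axis)
  define e where "e = csqrt c"
  have e: "cmod e = 1" "e\<^sup>2 = c"
    using c by (simp_all add: e_def)
  have "A = ?T ** (transpose ?T ** A)"
    by (simp add: matrix_mul_assoc orth)
  also have "\<dots> = quaternion_rotation (z * e) (w * cnj e)"
    using e by (simp add: c quaternion_rotation_mult_plane flip: e(2))
  finally show thesis
    using that [of "z * e" "w * cnj e"] zw e by (simp add: norm_mult)
qed


definition unit_quaternions :: "(complex \<times> complex) set" where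
  "unit_quaternions = {(z, w). (cmod z)\<^sup>2 + (cmod w)\<^sup>2 = 1}"

lemma compact_unit_quaternions: "compact unit_quaternions"
proof -
  have "unit_quaternions = sphere 0 1"
    by (auto simp: unit_quaternions_def norm_Pair)
  then show ?thesis
    by (metis compact_sphere)
qed

lemma continuous_on_vector3:
  fixes f g h :: "'a::topological_space \<Rightarrow> 'b::real_normed_vector"
  assumes "continuous_on S f" "continuous_on S g" "continuous_on S h"
  shows "continuous_on S (\<lambda>x. vector [f x, g x, h x] :: 'b ^ 3)"
proof -
  have "(vector [f x, g x, h x] :: 'b ^ 3) = (\<chi> i. (if i = 1 then f else if i = 2 then g else h) x)" for x
    by (simp add: vec_eq_iff forall_3)
  then show ?thesis
    using assms by (simp only:) (rule continuous_on_vec_lambda, simp)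
qed

lemma continuous_on_quaternion_rotation:
  "continuous_on S (\<lambda>(z, w). quaternion_rotation z w)"
  unfolding quaternion_rotation_def case_prod_unfold
  by (intro continuous_on_vector3 continuous_intros)

text \<open>The conjugation by \<open>P\<close> allows the distinguished axis to be chosen freely.\<close>

lemma quotient_map_SO3:
  assumes P: "P \<in> carrier SO3"
  shows "quotient_map (top_of_set unit_quaternions) (top_of_set (carrier SO3))
    (\<lambda>(z, w). P ** quaternion_rotation z w ** transpose P)"
proof (rule continuous_imp_quotient_map)
  interpret S: Group.group SO3 by (rule group_SO3)
  have tP: "transpose P \<in> carrier SO3"
    using P S.inv_closed inv_SO3 by fastforce
  have closed: "A ** B \<in> carrier SO3" if "A \<in> carrier SO3" "B \<in> carrier SO3" for A B
    using S.m_closed [OF that] by (simp add: SO3_def)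
  have orth: "P ** transpose P = mat 1"
    using P by (simp add: SO3_def orthogonal_matrix_def)
  let ?f = "\<lambda>(z, w). P ** quaternion_rotation z w ** transpose P"
  have into: "?f ` unit_quaternions \<subseteq> carrier SO3"
    using P tP by (auto simp: unit_quaternions_def intro!: closed quaternion_rotation_in_SO3)
  moreover have "A \<in> ?f ` unit_quaternions" if A: "A \<in> carrier SO3" for A
  proof -
    have "transpose P ** A ** P \<in> carrier SO3"
      using P tP A by (intro closed)
    then obtain z w where zw: "(cmod z)\<^sup>2 + (cmod w)\<^sup>2 = 1" "transpose P ** A ** P = quaternion_rotation z w"
      by (rule SO3_quaternion_rotation)
    have "?f (z, w) = (P ** transpose P) ** A ** (P ** transpose P)"
      by (simp add: matrix_mul_assoc flip: zw(2))
    then have "?f (z, w) = A"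
      by (simp add: orth)
    then show ?thesis
      using zw(1) by (force simp: unit_quaternions_def)
  qed
  ultimately show "?f ` topspace (top_of_set unit_quaternions) = topspace (top_of_set (carrier SO3))"
    by auto
  have "continuous_on unit_quaternions ?f"
    unfolding case_prod_unfold matrix_matrix_mult_def
    using continuous_on_quaternion_rotation [of unit_quaternions, unfolded case_prod_unfold]
    by (intro continuous_intros) auto
  with into show "continuous_map (top_of_set unit_quaternions) (top_of_set (carrier SO3)) ?f"
    by (auto simp: image_subset_iff_funcset)
  show "compact_space (top_of_set unit_quaternions)"
    by (simp add: compact_space_subtopology compact_unit_quaternions)
  show "Hausdorff_space (top_of_set (carrier SO3))"
    by (simp add: Hausdorff_space_subtopology)
qed


section \<open>Projective three-space\<close>

definition complex_pair :: "complex \<Rightarrow> complex \<Rightarrow> real ^ 4" where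
  "complex_pair z w = vector [Re z, Im z, Re w, Im w]"

lemma vector_4:
  "(vector [a, b, c, d] :: 'a::zero ^ 4) $ 1 = a"
  "(vector [a, b, c, d] :: 'a::zero ^ 4) $ 2 = b"
  "(vector [a, b, c, d] :: 'a::zero ^ 4) $ 3 = c"
  "(vector [a, b, c, d] :: 'a::zero ^ 4) $ 4 = d"
  unfolding vector_def by simp_all

lemma complex_pair_surj: obtains z w where "x = complex_pair z w"
proof
  show "x = complex_pair (Complex (x$1) (x$2)) (Complex (x$3) (x$4))"
    by (simp add: complex_pair_def vec_eq_iff forall_4 vector_4)
qed

lemma complex_pair_eq_iff: "complex_pair z w = complex_pair z' w' \<longleftrightarrow> z = z' \<and> w = w'"
  by (auto simp: complex_pair_def vec_eq_iff forall_4 vector_4 complex_eq_iff)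

lemma complex_pair_eq_0_iff: "complex_pair z w = 0 \<longleftrightarrow> z = 0 \<and> w = 0"
  by (auto simp: complex_pair_def vec_eq_iff forall_4 vector_4 complex_eq_iff)

lemma scaleR_complex_pair: "t *\<^sub>R complex_pair z w = complex_pair (of_real t * z) (of_real t * w)"
  by (simp add: complex_pair_def vec_eq_iff forall_4 vector_4)

lemma continuous_on_complex_pair:
  assumes "continuous_on S f" "continuous_on S g"
  shows "continuous_on S (\<lambda>x. complex_pair (f x) (g x))"
proof -
  have "complex_pair (f x) (g x) = (\<chi> i. (if i = 1 then \<lambda>x. Re (f x) else if i = 2 then \<lambda>x. Im (f x)
      else if i = 3 then \<lambda>x. Re (g x) else (\<lambda>x. Im (g x))) x)" for x
    by (simp add: complex_pair_def vec_eq_iff forall_4 vector_4)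
  then show ?thesis
    using assms
    by (simp only:) (rule continuous_on_vec_lambda, simp add: continuous_on_Re continuous_on_Im)
qed

text \<open>If \<open>(z ^ n, w ^ n)\<close> is \<open>t\<close> times \<open>(z' ^ n, w' ^ n)\<close>, then \<open>(\<bar>z\<bar>, \<bar>w\<bar>)\<close> is
  \<open>(\<bar>z'\<bar>, \<bar>w'\<bar>)\<close> scaled by the \<open>n\<close>-th root of \<open>\<bar>t\<bar>\<close>; both have norm one, so
  \<open>\<bar>t\<bar> = 1\<close>.\<close>

lemma unit_powers_span_eq_iff:
  assumes n: "n \<ge> 1"
    and zw: "(cmod z)\<^sup>2 + (cmod w)\<^sup>2 = 1" and zw': "(cmod z')\<^sup>2 + (cmod w')\<^sup>2 = 1"
  shows "span {complex_pair (z ^ n) (w ^ n)} = span {complex_pair (z' ^ n) (w' ^ n)} \<longleftrightarrow>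
    (\<exists>s\<in>{1, -1}. z ^ n = s * z' ^ n \<and> w ^ n = s * w' ^ n)"
    (is "?lhs \<longleftrightarrow> ?rhs")
proof -
  have nz: "complex_pair (z ^ n) (w ^ n) \<noteq> 0" "complex_pair (z' ^ n) (w' ^ n) \<noteq> 0"
    using zw zw' n by (auto simp: complex_pair_eq_0_iff)
  have lhs: "?lhs \<longleftrightarrow> (\<exists>t::real. z ^ n = of_real t * z' ^ n \<and> w ^ n = of_real t * w' ^ n)"
    by (simp add: span_singleton_eq_iff [OF nz] scaleR_complex_pair complex_pair_eq_iff)
  show ?thesis
  proof
    assume ?lhs
    then obtain t :: real where t: "z ^ n = of_real t * z' ^ n" "w ^ n = of_real t * w' ^ n"
      using lhs by blast
    define r where "r = root n \<bar>t\<bar>"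
    have r: "r \<ge> 0" "r ^ n = \<bar>t\<bar>"
      using n by (simp_all add: r_def)
    have "cmod z ^ n = (r * cmod z') ^ n" "cmod w ^ n = (r * cmod w') ^ n"
      using arg_cong [OF t(1), of cmod] arg_cong [OF t(2), of cmod]
      by (simp_all add: norm_mult norm_power power_mult_distrib r)
    then have "cmod z = r * cmod z'" "cmod w = r * cmod w'"
      using n r by (auto intro: power_eq_imp_eq_base [of _ n])
    with zw have "r\<^sup>2 * ((cmod z')\<^sup>2 + (cmod w')\<^sup>2) = 1"
      by (simp add: power_mult_distrib distrib_left)
    then have "r = 1"
      using r by (simp add: zw' power2_eq_1_iff)
    then have "t = 1 \<or> t = -1"
      using r by auto
    then show ?rhs
      using t by auto
  next
    assume ?rhs
    then show ?lhs
      unfolding lhs by (metis empty_iff insertE of_real_1 of_real_minus)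
  qed
qed

text \<open>Surjectivity: every nonzero vector of \<open>\<complex>\<^sup>2\<close> has the form \<open>(z ^ n, w ^ n)\<close>, and scaling
  \<open>(z, w)\<close> to norm one does not change the real line spanned by the powers.\<close>

lemma quotient_map_RP3:
  assumes n: "n \<ge> 1"
  shows "quotient_map (top_of_set unit_quaternions) RP3
    (\<lambda>(z, w). span {complex_pair (z ^ n) (w ^ n)})"
proof (rule continuous_imp_quotient_map)
  let ?f = "\<lambda>(z, w). complex_pair (z ^ n) (w ^ n)"
  let ?q = "\<lambda>x :: real ^ 4. span {x}"
  have comp: "(\<lambda>(z, w). span {complex_pair (z ^ n) (w ^ n)}) = ?q \<circ> ?f"
    by auto
  have into: "?f ` unit_quaternions \<subseteq> - {0}"
    using n by (auto simp: unit_quaternions_def complex_pair_eq_0_iff)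
  have "continuous_on unit_quaternions ?f"
    unfolding case_prod_unfold by (intro continuous_on_complex_pair continuous_intros)
  with into have "continuous_map (top_of_set unit_quaternions) (top_of_set (- {0})) ?f"
    by (simp only: continuous_map_subtopology_eu image_subset_iff_funcset)
  moreover have q: "quotient_map (top_of_set (- {0})) RP3 ?q"
    unfolding real_projective_space_def by (rule quotient_map_quot_topology)
  ultimately show "continuous_map (top_of_set unit_quaternions) RP3
      (\<lambda>(z, w). span {complex_pair (z ^ n) (w ^ n)})"
    unfolding comp by (metis continuous_map_compose quotient_imp_continuous_map)
  show "(\<lambda>(z, w). span {complex_pair (z ^ n) (w ^ n)}) ` topspace (top_of_set unit_quaternions) =
      topspace RP3"
  proof -
    have "?q x \<in> (?q \<circ> ?f) ` unit_quaternions" if "x \<noteq> 0" for x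
    proof -
      obtain u v where x: "x = complex_pair u v"
        by (rule complex_pair_surj)
      obtain z w where zw: "u = z ^ n" "v = w ^ n"
        using n exists_complex_root [of n] by (metis not_one_le_zero)
      define r where "r = sqrt ((cmod z)\<^sup>2 + (cmod w)\<^sup>2)"
      have "z \<noteq> 0 \<or> w \<noteq> 0"
        using \<open>x \<noteq> 0\<close> n by (auto simp: x zw complex_pair_eq_0_iff)
      then have r: "r > 0" "r\<^sup>2 = (cmod z)\<^sup>2 + (cmod w)\<^sup>2"
        by (auto simp: r_def sum_power2_gt_zero_iff)
      let ?p = "(z / of_real r, w / of_real r)"
      have "?p \<in> unit_quaternions"
        using r \<open>z \<noteq> 0 \<or> w \<noteq> 0\<close>
        by (simp add: unit_quaternions_def norm_divide power_divide flip: add_divide_distrib)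
      have "x = r ^ n *\<^sub>R ?f ?p"
        using r by (simp add: x zw scaleR_complex_pair power_divide)
      then have "?q x = ?q (?f ?p)"
        using \<open>x \<noteq> 0\<close> by (subst span_singleton_eq_iff) auto
      then show ?thesis
        using \<open>?p \<in> unit_quaternions\<close> by (intro image_eqI [of _ _ ?p]) simp_all
    qed
    then have "?q ` (- {0}) \<subseteq> (?q \<circ> ?f) ` unit_quaternions"
      by (intro image_subsetI) simp
    moreover have "(?q \<circ> ?f) ` unit_quaternions \<subseteq> ?q ` (- {0})"
      unfolding image_comp [symmetric] by (rule image_mono [OF into])
    moreover have "?q ` (- {0}) = topspace RP3"
      using quotient_imp_surjective_map [OF q] by simp
    ultimately show ?thesis
      unfolding comp topspace_euclidean_subtopology by (simp only: subset_antisym)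
  qed
  show "compact_space (top_of_set unit_quaternions)"
    by (simp add: compact_space_subtopology compact_unit_quaternions)
qed (rule Hausdorff_real_projective_space)


section \<open>Orbits of the cyclic group\<close>

text \<open>In coordinates with the axis of \<open>R\<close> as third axis, \<open>R\<close> is rotation by a root of unity
  of order dividing \<open>n\<close>, so the group it generates lies in the group of all these rotations.
  Both have \<open>n\<close> elements.\<close>

lemma generate_axial_rotation:
  assumes n: "n \<ge> 1" and R: "axial_rotation R" and ord: "group.ord SO3 R = n"
  obtains P where "P \<in> carrier SO3"
    "generate SO3 {R} = {P ** plane_rotation c ** transpose P | c. c ^ n = 1}"
proof -
  interpret S: Group.group SO3 by (rule group_SO3)
  obtain u where RS: "R \<in> carrier SO3" and u: "u \<noteq> 0" "R *v u = u"
    using R by (auto simp: axial_rotation_def)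
  define v where "v = u /\<^sub>R norm u"
  have v: "norm v = 1" "R *v v = v"
    using u by (simp_all add: v_def matrix_vector_mult_scaleR)
  obtain P where "rotation_matrix P" and Pv: "P *v axis (3::3) 1 = v"
    using v by (auto intro: rotation_matrix_exists_basis [of v 3])
  then have P: "P \<in> carrier SO3"
    by (simp add: rotation_matrix_def SO3_def)
  then have tP: "transpose P \<in> carrier SO3"
    using S.inv_closed inv_SO3 by fastforce
  have closed: "A ** B \<in> carrier SO3" if "A \<in> carrier SO3" "B \<in> carrier SO3" for A B
    using S.m_closed [OF that] by (simp add: SO3_def)
  have orth: "P ** transpose P = mat 1" "transpose P ** P = mat 1"
    using P by (simp_all add: SO3_def orthogonal_matrix_def)
  define \<phi> where "\<phi> c = P ** plane_rotation c ** transpose P" for c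
  have \<phi>_mult: "\<phi> c ** \<phi> d = \<phi> (c * d)" for c d
  proof -
    have "\<phi> c ** \<phi> d = P ** plane_rotation c ** (transpose P ** P) ** plane_rotation d ** transpose P"
      by (simp add: \<phi>_def matrix_mul_assoc)
    then show ?thesis
      by (simp add: orth \<phi>_def plane_rotation_mult flip: matrix_mul_assoc)
  qed
  have \<phi>_1: "\<phi> 1 = mat 1"
    by (simp add: \<phi>_def plane_rotation_1 orth)
  have \<phi>_inj: "c = d" if "\<phi> c = \<phi> d" for c d
  proof -
    have "plane_rotation c = transpose P ** \<phi> c ** P" for c
    proof -
      have "transpose P ** \<phi> c ** P = (transpose P ** P) ** plane_rotation c ** (transpose P ** P)"
        by (simp add: \<phi>_def matrix_mul_assoc)
      then show ?thesis by (simp add: orth)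
    qed
    then show ?thesis
      using that by (metis plane_rotation_eq_iff)
  qed
  have \<phi>_SO3: "\<phi> c \<in> carrier SO3" if "cmod c = 1" for c
    unfolding \<phi>_def using P tP plane_rotation_in_SO3 [OF that] by (intro closed)
  have \<phi>_pow: "\<phi> c [^]\<^bsub>SO3\<^esub> k = \<phi> (c ^ k)" for c and k :: nat
    by (induction k) (simp_all add: \<phi>_1 \<phi>_mult SO3_def mult.commute)
  have "(transpose P ** R ** P) *v axis 3 1 = axis 3 1"
  proof -
    have "(transpose P ** R ** P) *v axis 3 1 = transpose P *v (R *v (P *v axis 3 1))"
      by (simp add: matrix_vector_mul_assoc matrix_mul_assoc)
    also have "\<dots> = transpose P *v (P *v axis 3 1)"
      by (simp add: Pv v)
    finally show ?thesis
      by (simp add: matrix_vector_mul_assoc orth)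
  qed
  moreover have "transpose P ** R ** P \<in> carrier SO3"
    using P tP RS by (intro closed)
  ultimately obtain c where c: "transpose P ** R ** P = plane_rotation c"
    by (metis SO3_fixing_axis)
  have "\<phi> c = (P ** transpose P) ** R ** (P ** transpose P)"
    by (simp add: \<phi>_def matrix_mul_assoc flip: c)
  then have R_eq: "R = \<phi> c"
    by (simp add: orth)
  have "\<phi> (c ^ n) = \<phi> 1"
    using S.pow_ord_eq_1 [OF RS] by (simp add: ord) (simp add: R_eq \<phi>_pow, simp add: \<phi>_1 SO3_def)
  then have cn: "c ^ n = 1"
    by (rule \<phi>_inj)
  let ?D = "\<phi> ` {c. c ^ n = 1}"
  have cmod1: "cmod d = 1" if "d ^ n = 1" for d
    using that n by (metis norm_one norm_power norm_ge_zero power_eq_1_iff not_one_le_zero)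
  have "subgroup ?D SO3"
  proof (rule S.subgroupI)
    show "?D \<subseteq> carrier SO3"
      using cmod1 \<phi>_SO3 by auto
    show "?D \<noteq> {}"
      using cn by auto
    show "inv\<^bsub>SO3\<^esub> A \<in> ?D" if A: "A \<in> ?D" for A
    proof -
      obtain d where d: "A = \<phi> d" "d ^ n = 1"
        using A by blast
      have "inv\<^bsub>SO3\<^esub> A = \<phi> (cnj d)"
        using d cmod1 \<phi>_SO3
        by (simp add: inv_SO3) (simp add: \<phi>_def matrix_transpose_mul transpose_plane_rotation matrix_mul_assoc)
      moreover have "cnj d ^ n = 1"
        using d(2) by (metis complex_cnj_one complex_cnj_power)
      ultimately show ?thesis by blast
    qed
    show "A \<otimes>\<^bsub>SO3\<^esub> B \<in> ?D" if "A \<in> ?D" "B \<in> ?D" for A B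
      using that by (auto simp: SO3_def \<phi>_mult power_mult_distrib)
  qed
  then have "generate SO3 {R} \<subseteq> ?D"
    using cn by (intro S.generate_subgroup_incl) (auto simp: R_eq)
  moreover have fin: "finite {c::complex. c ^ n = 1}"
    using n by (simp add: finite_roots_unity)
  moreover have "card ?D \<le> n"
    using card_image_le [OF fin, of \<phi>] n by (simp add: card_roots_unity_eq)
  moreover have "card (generate SO3 {R}) = n"
    using S.generate_pow_card [OF RS] ord by simp
  ultimately have "generate SO3 {R} = ?D"
    by (intro card_seteq) auto
  with P that show thesis
    by (auto simp: \<phi>_def image_def intro!: that [of P])
qed

lemma orbit_eq_iff:
  assumes G: "subgroup G SO3"
    and A: "A \<in> carrier SO3" and B: "B \<in> carrier SO3"
  shows "orbit (SO3\<lparr>carrier := G\<rparr> \<times>\<times> SO3\<lparr>carrier := G\<rparr>) misorientation_action A =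
      orbit (SO3\<lparr>carrier := G\<rparr> \<times>\<times> SO3\<lparr>carrier := G\<rparr>) misorientation_action B \<longleftrightarrow>
    (\<exists>g\<in>G. \<exists>h\<in>G. A = g ** B ** h)"
proof -
  let ?G = "SO3\<lparr>carrier := G\<rparr> \<times>\<times> SO3\<lparr>carrier := G\<rparr>"
  interpret S: Group.group SO3 by (rule group_SO3)
  interpret G: subgroup G SO3 by fact
  interpret act: group_action ?G "carrier SO3" misorientation_action
    by (rule group_action_misorientation [OF G G])
  have "orbit ?G misorientation_action A = orbit ?G misorientation_action B \<longleftrightarrow>
      A \<in> orbit ?G misorientation_action B"
  proof
    assume "orbit ?G misorientation_action A = orbit ?G misorientation_action B"
    then show "A \<in> orbit ?G misorientation_action B"
      using act.orbit_refl [OF A] by simp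
  next
    assume "A \<in> orbit ?G misorientation_action B"
    then show "orbit ?G misorientation_action A = orbit ?G misorientation_action B"
      using act.disjoint_union [of "orbit ?G misorientation_action A" "orbit ?G misorientation_action B"]
        act.orbit_refl [OF A] A B by (auto simp: orbits_def)
  qed
  also have "\<dots> \<longleftrightarrow> (\<exists>g\<in>G. \<exists>h\<in>G. A = g \<otimes>\<^bsub>SO3\<^esub> B \<otimes>\<^bsub>SO3\<^esub> inv\<^bsub>SO3\<^esub> h)"
    using B by (auto simp: orbit_def misorientation_action_def)
  also have "\<dots> \<longleftrightarrow> (\<exists>g\<in>G. \<exists>h\<in>G. A = g \<otimes>\<^bsub>SO3\<^esub> B \<otimes>\<^bsub>SO3\<^esub> h)"
    by (metis G.m_inv_closed G.mem_carrier S.inv_inv)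
  finally show ?thesis
    by (simp add: SO3_def)
qed

text \<open>Dividing \<open>z\<close> by \<open>z'\<close> is not possible when both vanish; then any \<open>n\<close>-th root
  of \<open>s\<close> will do.\<close>

lemma exists_unit_factor:
  fixes z z' s :: complex
  assumes n: "n \<ge> 1" and s: "cmod s = 1" and eq: "z ^ n = s * z' ^ n"
  obtains \<alpha> where "\<alpha> ^ n = s" "z = \<alpha> * z'"
proof (cases "z' = 0")
  case True
  with eq n have "z = 0" by (simp add: power_0_left)
  moreover obtain \<alpha> where "\<alpha> ^ n = s"
    using n exists_complex_root [of n s] by (metis not_one_le_zero)
  ultimately show thesis
    using that True by simp
next
  case False
  with eq show thesis
    by (intro that [of "z / z'"]) (simp_all add: power_divide)
qed

text \<open>With square roots \<open>e\<close> and \<open>f\<close> of \<open>c\<close> and \<open>d\<close>, the triple product is the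
  quaternion rotation of \<open>(e f z', e f\<^sup>* w')\<close>. The powers \<open>e ^ n\<close> and \<open>f ^ n\<close> are
  \<open>1\<close> or \<open>- 1\<close>, so \<open>f ^ n\<close> equals its own conjugate, and the \<open>n\<close>-th powers of both
  coordinates change by the same sign. Conversely, factors \<open>\<alpha>\<close> and \<open>\<beta>\<close> with
  \<open>\<alpha> ^ n = \<beta> ^ n = s\<close> are recovered as \<open>e f\<close> and \<open>e f\<^sup>*\<close> from \<open>e\<^sup>2 = \<alpha> \<beta>\<close> and
  \<open>f\<^sup>2 = \<alpha> / \<beta>\<close>.\<close>

lemma double_coset_iff_powers:
  assumes n: "n \<ge> 1"
  shows "(\<exists>c d. c ^ n = 1 \<and> d ^ n = 1 \<and>
        quaternion_rotation z w = plane_rotation c ** quaternion_rotation z' w' ** plane_rotation d) \<longleftrightarrow>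
    (\<exists>s\<in>{1, -1}. z ^ n = s * z' ^ n \<and> w ^ n = s * w' ^ n)"
    (is "?lhs \<longleftrightarrow> ?rhs")
proof -
  have cmod1: "cmod d = 1" if "d ^ k = 1" "k \<ge> 1" for d :: complex and k
    using that by (metis norm_one norm_power norm_ge_zero power_eq_1_iff not_one_le_zero)
  have cnj: "cnj f = inverse f" if "cmod f = 1" for f
    using inverse_unique [of f "cnj f"] complex_norm_square [of f] that by simp
  show ?thesis
  proof
    assume ?lhs
    then obtain c d where cd: "c ^ n = 1" "d ^ n = 1"
      and eq: "quaternion_rotation z w = plane_rotation c ** quaternion_rotation z' w' ** plane_rotation d"
      by blast
    define e f where "e = csqrt c" "f = csqrt d"
    have ef: "e\<^sup>2 = c" "f\<^sup>2 = d" "cmod e = 1" "cmod f = 1"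
      using cmod1 n cd by (simp_all add: e_f_def)
    have "(e ^ n)\<^sup>2 = 1" "(f ^ n)\<^sup>2 = 1"
      using cd ef by (metis power_commutes power_mult mult.commute)+
    then have efn: "e ^ n \<in> {1, -1}" "f ^ n \<in> {1, -1}" "inverse (f ^ n) = f ^ n"
      by (auto simp: power2_eq_1_iff)
    have "quaternion_rotation z w = quaternion_rotation (e * z' * f) (e * w' * cnj f)"
      by (simp only: eq ef(1,2) [symmetric] quaternion_rotation_plane_mult [OF ef(3)]
          quaternion_rotation_mult_plane [OF ef(4)])
    then obtain t :: complex where t: "t \<in> {1, -1}" "z = t * (e * z' * f)" "w = t * (e * w' * cnj f)"
      unfolding quaternion_rotation_eq_iff by force
    \<comment> \<open>\<open>t\<close> is the sign left open by the double cover.\<close>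
    define s where "s = t ^ n * e ^ n * f ^ n"
    have "t ^ n \<in> {1, -1}"
      using t(1) by (cases "even n") auto
    then have "s \<in> {1, -1}"
      using efn by (auto simp: s_def)
    moreover have "z ^ n = s * z' ^ n"
      by (simp add: t(2) s_def power_mult_distrib mult_ac)
    moreover have "w ^ n = s * w' ^ n"
      using efn(3) by (simp add: t(3) s_def power_mult_distrib mult_ac cnj ef power_inverse)
    ultimately show ?rhs by blast
  next
    assume ?rhs
    then obtain s where s: "s \<in> {1, -1}" and zn: "z ^ n = s * z' ^ n" and wn: "w ^ n = s * w' ^ n"
      by blast
    then have s1: "cmod s = 1" "s * s = 1" "s \<noteq> 0"
      by auto
    obtain \<alpha> where \<alpha>: "\<alpha> ^ n = s" "z = \<alpha> * z'"
      using exists_unit_factor [OF n s1(1) zn] by blast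
    obtain \<beta> where \<beta>: "\<beta> ^ n = s" "w = \<beta> * w'"
      using exists_unit_factor [OF n s1(1) wn] by blast
    have nz: "\<alpha> \<noteq> 0" "\<beta> \<noteq> 0"
      using \<alpha>(1) \<beta>(1) s1(3) n by (auto simp: power_0_left)
    have c: "(\<alpha> * \<beta>) ^ n = 1" and d: "(\<alpha> / \<beta>) ^ n = 1"
      using s1 by (simp_all add: power_mult_distrib power_divide \<alpha> \<beta>)
    define e where "e = csqrt (\<alpha> * \<beta>)"
    define f where "f = \<alpha> / e"
    have e: "e\<^sup>2 = \<alpha> * \<beta>"
      by (simp add: e_def)
    then have e0: "e \<noteq> 0"
      using nz by auto
    have f: "f\<^sup>2 = \<alpha> / \<beta>"
      using nz by (simp add: f_def power_divide e) (simp add: power2_eq_square)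
    have "cmod (e\<^sup>2) = 1" "cmod (f\<^sup>2) = 1"
      unfolding e f using cmod1 [OF c n] cmod1 [OF d n] by simp_all
    then have ef1: "cmod e = 1" "cmod f = 1"
      by (simp_all add: norm_power power2_eq_1_iff) (use norm_ge_zero [of e] norm_ge_zero [of f] in linarith)+
    have "\<alpha> = e * f"
      using e0 by (simp add: f_def)
    then have "z = e * z' * f"
      by (simp add: \<alpha>(2) mult_ac)
    moreover have "\<beta> = e * cnj f"
      using e e0 nz by (simp add: cnj ef1) (simp add: f_def field_simps power2_eq_square)
    then have "w = e * w' * cnj f"
      by (simp add: \<beta>(2) mult_ac)
    ultimately have "quaternion_rotation z w = quaternion_rotation (e * z' * f) (e * w' * cnj f)"
      by simp
    also have "\<dots> = plane_rotation (e\<^sup>2) ** quaternion_rotation z' w' ** plane_rotation (f\<^sup>2)"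
      using ef1 by (simp add: quaternion_rotation_plane_mult quaternion_rotation_mult_plane)
    finally show ?lhs
      using c d unfolding e f by blast
  qed
qed

theorem proposition3p3:
  fixes n :: nat and R :: "real ^ 3 ^ 3" and C :: "(real ^ 3 ^ 3) set"
  assumes "n \<ge> 1"
    and "axial_rotation R"
    and "group.ord SO3 R = n"
    and "C = generate SO3 {R}"
  shows "misorientation_space C C homeomorphic_space RP3"
proof -
  obtain P where P: "P \<in> carrier SO3"
    and "generate SO3 {R} = {P ** plane_rotation c ** transpose P | c. c ^ n = 1}"
    by (rule generate_axial_rotation [OF assms(1-3)])
  then have C: "C = {P ** plane_rotation c ** transpose P | c. c ^ n = 1}"
    using assms(4) by simp
  have orth: "transpose P ** P = mat 1"
    using P by (simp add: SO3_def orthogonal_matrix_def)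
  have sub: "subgroup C SO3"
    using assms by (auto simp: axial_rotation_def intro!: finite_subgroup_generate_SO3)
  let ?orb = "orbit (SO3\<lparr>carrier := C\<rparr> \<times>\<times> SO3\<lparr>carrier := C\<rparr>) misorientation_action"
  define \<psi> where "\<psi> A = P ** A ** transpose P" for A
  have \<psi>_mult: "\<psi> A ** \<psi> B = \<psi> (A ** B)" for A B
  proof -
    have "\<psi> A ** \<psi> B = P ** A ** (transpose P ** P) ** B ** transpose P"
      by (simp add: \<psi>_def matrix_mul_assoc)
    then show ?thesis
      by (simp add: orth) (simp add: \<psi>_def matrix_mul_assoc)
  qed
  have \<psi>_eq_iff: "\<psi> A = \<psi> B \<longleftrightarrow> A = B" for A B
  proof -
    have "transpose P ** \<psi> A ** P = A" for A
    proof -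
      have "transpose P ** \<psi> A ** P = (transpose P ** P) ** A ** (transpose P ** P)"
        by (simp add: \<psi>_def matrix_mul_assoc)
      then show ?thesis by (simp add: orth)
    qed
    then show ?thesis by metis
  qed
  let ?f = "\<lambda>(z, w). \<psi> (quaternion_rotation z w)"
  have f: "quotient_map (top_of_set unit_quaternions) (top_of_set (carrier SO3)) ?f"
    unfolding \<psi>_def by (rule quotient_map_SO3 [OF P])
  moreover have "quotient_map (top_of_set (carrier SO3)) (misorientation_space C C) ?orb"
    unfolding misorientation_space_def orbit_space_def by (rule quotient_map_quot_topology)
  ultimately have "quotient_map (top_of_set unit_quaternions) (misorientation_space C C) (?orb \<circ> ?f)"
    by (rule quotient_map_compose)
  moreover have "quotient_map (top_of_set unit_quaternions) RP3
      (\<lambda>(z, w). span {complex_pair (z ^ n) (w ^ n)})"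
    using assms(1) by (rule quotient_map_RP3)
  ultimately show ?thesis
  proof (rule homeomorphic_space_quotient_maps)
    fix p p'
    assume "p \<in> topspace (top_of_set unit_quaternions)" "p' \<in> topspace (top_of_set unit_quaternions)"
    then obtain z w z' w' where p: "p = (z, w)" "p' = (z', w')"
      and zw: "(cmod z)\<^sup>2 + (cmod w)\<^sup>2 = 1" and zw': "(cmod z')\<^sup>2 + (cmod w')\<^sup>2 = 1"
      by (auto simp: unit_quaternions_def)
    have "?f p \<in> carrier SO3" "?f p' \<in> carrier SO3"
      using quotient_imp_surjective_map [OF f] zw zw' by (auto simp: p unit_quaternions_def)
    then have "(?orb \<circ> ?f) p = (?orb \<circ> ?f) p' \<longleftrightarrow> (\<exists>g\<in>C. \<exists>h\<in>C. ?f p = g ** ?f p' ** h)"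
      using orbit_eq_iff [OF sub] by simp
    also have "\<dots> \<longleftrightarrow> (\<exists>c d. c ^ n = 1 \<and> d ^ n = 1 \<and>
        \<psi> (quaternion_rotation z w) =
          \<psi> (plane_rotation c) ** \<psi> (quaternion_rotation z' w') ** \<psi> (plane_rotation d))"
      unfolding C p \<psi>_def by auto
    also have "\<dots> \<longleftrightarrow> (\<exists>s\<in>{1, -1}. z ^ n = s * z' ^ n \<and> w ^ n = s * w' ^ n)"
      unfolding \<psi>_mult \<psi>_eq_iff by (rule double_coset_iff_powers [OF assms(1)])
    also have "\<dots> \<longleftrightarrow> (\<lambda>(z, w). span {complex_pair (z ^ n) (w ^ n)}) p =
        (\<lambda>(z, w). span {complex_pair (z ^ n) (w ^ n)}) p'"
      by (simp only: p case_prod_conv unit_powers_span_eq_iff [OF assms(1) zw zw'])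
    finally show "(?orb \<circ> ?f) p = (?orb \<circ> ?f) p' \<longleftrightarrow>
        (\<lambda>(z, w). span {complex_pair (z ^ n) (w ^ n)}) p =
        (\<lambda>(z, w). span {complex_pair (z ^ n) (w ^ n)}) p'" .
  qed
qed

end
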